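(* Let $\mathcal{L}_2$ be the three-dimensional BiHom-Lie algebra over $\mathbb{C}$ with basis $\{e_1,e_2,e_3\}$, structure maps $\alpha_2=\mathrm{id}$ and $\beta_2=\begin{pmatrix}1&1&0\\0&1&1\\0&0&1\end{pmatrix}$, and brackets $$[e_1,e_2]=2e_1,\quad [e_1,e_3]=e_1+2e_2,\quad [e_2,e_1]=-2e_1,\quad [e_2,e_2]=-2e_1,\quad [e_2,e_3]=e_1+e_2+2e_3,$$ $$[e_3,e_1]=e_1-2e_2,\quad [e_3,e_2]=-3e_2-2e_3,\quad [e_3,e_3]=-e_1-e_2-2e_3,\quad [e_1,e_1]=0.$$ Then the Nijenhuis operators on $\mathcal{L}_2$ are exactly the linear maps with matrix $$N=\begin{pmatrix} r_{33}&0&r_{13}\\0&r_{33}&0\\0&0&r_{33}\end{pmatrix},\qquad r_{33},r_{13}\in\mathbb{C}.$$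
   Context: Matrices act by columns: a matrix $(m_{ij})$ represents the linear map $e_j\mapsto\sum_i m_{ij}e_i$. A BiHom-Lie algebra is a 4-tuple $(L,[\cdot,\cdot],\alpha,\beta)$ with $L$ a vector space over $\mathbb{C}$, $[\cdot,\cdot]:L\times L\to L$ bilinear, $\alpha,\beta:L\to L$ linear, such that for all $x,y,z\in L$: (i) $\alpha\circ\beta=\beta\circ\alpha$; (ii) $\alpha([x,y])=[\alpha(x),\alpha(y)]$ and $\beta([x,y])=[\beta(x),\beta(y)]$; (iii) $[\beta(x),\alpha(y)]=-[\beta(y),\alpha(x)]$; (iv) $[\beta^2(x),[\beta(y),\alpha(z)]]+[\beta^2(y),[\beta(z),\alpha(x)]]+[\beta^2(z),[\beta(x),\alpha(y)]]=0$. A linear map $N:L\to L$ is a Nijenhuis operator if $N\circ\alpha=\alpha\circ N$, $N\circ\beta=\beta\circ N$, and $[N(x),N(y)]=N([N(x),y]+[x,N(y)]-N[x,y])$ for all $x,y\in L$. *)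

theory Defs
  imports "HOL-Analysis.Analysis"
begin

(* "Vector_Spaces.linear scl scl" is complex-linearity; the unqualified library
   constant "linear" would only mean linearity over the reals. *)
locale bihom_lie_algebra = vector_space scl
  for scl :: "complex \<Rightarrow> 'a::ab_group_add \<Rightarrow> 'a" +
  fixes bracket :: "'a \<Rightarrow> 'a \<Rightarrow> 'a" and \<alpha> \<beta> :: "'a \<Rightarrow> 'a"
  assumes bracket_linear_right: "Vector_Spaces.linear scl scl (\<lambda>y. bracket x y)"
    and bracket_linear_left: "Vector_Spaces.linear scl scl (\<lambda>x. bracket x y)"
    and linear_alpha: "Vector_Spaces.linear scl scl \<alpha>"
    and linear_beta: "Vector_Spaces.linear scl scl \<beta>"
    and alpha_beta_commute: "\<alpha> \<circ> \<beta> = \<beta> \<circ> \<alpha>"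
    and alpha_bracket: "\<alpha> (bracket x y) = bracket (\<alpha> x) (\<alpha> y)"
    and beta_bracket: "\<beta> (bracket x y) = bracket (\<beta> x) (\<beta> y)"
    and bihom_skew: "bracket (\<beta> x) (\<alpha> y) = - bracket (\<beta> y) (\<alpha> x)"
    and bihom_jacobi:
      "bracket (\<beta> (\<beta> x)) (bracket (\<beta> y) (\<alpha> z))
       + bracket (\<beta> (\<beta> y)) (bracket (\<beta> z) (\<alpha> x))
       + bracket (\<beta> (\<beta> z)) (bracket (\<beta> x) (\<alpha> y)) = 0"

definition nijenhuis_operator ::
  "(complex \<Rightarrow> 'a::ab_group_add \<Rightarrow> 'a) \<Rightarrow> ('a \<Rightarrow> 'a \<Rightarrow> 'a) \<Rightarrow> ('a \<Rightarrow> 'a) \<Rightarrow> ('a \<Rightarrow> 'a) \<Rightarrow> ('a \<Rightarrow> 'a) \<Rightarrow> bool"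
  where
  "nijenhuis_operator scl bracket \<alpha> \<beta> N \<longleftrightarrow>
     Vector_Spaces.linear scl scl N \<and>
     N \<circ> \<alpha> = \<alpha> \<circ> N \<and>
     N \<circ> \<beta> = \<beta> \<circ> N \<and>
     (\<forall>x y. bracket (N x) (N y) = N (bracket (N x) y + bracket x (N y) - N (bracket x y)))"

abbreviation eb :: "3 \<Rightarrow> complex^3" where
  "eb i \<equiv> axis i 1"

definition alpha2 :: "complex^3 \<Rightarrow> complex^3" where
  "alpha2 = id"

(* Matrices are given by their rows, so "A *v eb j" is the j-th column of A. *)
definition beta2 :: "complex^3 \<Rightarrow> complex^3" where
  "beta2 = (*v) (vector [vector [1, 1, 0],
                         vector [0, 1, 1],
                         vector [0, 0, 1]])"

(* The entry in row i, column j is the bracket of eb i with eb j. *)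
definition bracket2_table :: "complex^3^3^3" where
  "bracket2_table = vector
    [vector [0,                   2 *s eb 1,                  eb 1 + 2 *s eb 2],
     vector [(-2) *s eb 1,         (-2) *s eb 1,               eb 1 + eb 2 + 2 *s eb 3],
     vector [eb 1 - 2 *s eb 2,      (-3) *s eb 2 - 2 *s eb 3,    - eb 1 - eb 2 - 2 *s eb 3]]"

definition bracket2 :: "complex^3 \<Rightarrow> complex^3 \<Rightarrow> complex^3" where
  "bracket2 x y = (\<Sum>i\<in>UNIV. \<Sum>j\<in>UNIV. (x $ i * y $ j) *s (bracket2_table $ i $ j))"

lemma bracket2_basis:
  "bracket2 (eb 1) (eb 1) = 0"
  "bracket2 (eb 1) (eb 2) = 2 *s eb 1"
  "bracket2 (eb 1) (eb 3) = eb 1 + 2 *s eb 2"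
  "bracket2 (eb 2) (eb 1) = (-2) *s eb 1"
  "bracket2 (eb 2) (eb 2) = (-2) *s eb 1"
  "bracket2 (eb 2) (eb 3) = eb 1 + eb 2 + 2 *s eb 3"
  "bracket2 (eb 3) (eb 1) = eb 1 - 2 *s eb 2"
  "bracket2 (eb 3) (eb 2) = (-3) *s eb 2 - 2 *s eb 3"
  "bracket2 (eb 3) (eb 3) = - eb 1 - eb 2 - 2 *s eb 3"
  by (simp_all add: bracket2_def bracket2_table_def sum_3 axis_def)

lemma beta2_basis:
  "beta2 (eb 1) = eb 1"
  "beta2 (eb 2) = eb 1 + eb 2"
  "beta2 (eb 3) = eb 2 + eb 3"
  by (simp_all add: beta2_def vec_eq_iff forall_3 matrix_vector_mult_def sum_3 axis_def)

end

theory Submission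
  imports Defs
begin

text \<open>
  The bracket of \<open>\<L>\<^sub>2\<close> is a twist of an ordinary Lie bracket: writing \<open>\<beta>\<close> for \<open>beta2\<close>, one has
  \<open>[x, y] = {x, \<beta> y}\<close>, where \<open>{\<cdot>, \<cdot>}\<close> is a Lie bracket (a copy of \<open>sl\<^sub>2\<close>) of which \<open>\<beta>\<close> is an
  endomorphism.  The BiHom axioms for \<open>[\<cdot>, \<cdot>]\<close> are then the antisymmetry and Jacobi identities of
  \<open>{\<cdot>, \<cdot>}\<close> with powers of \<open>\<beta>\<close> moved inside (\<open>bihom_lie_algebra_twist\<close>).

  For the Nijenhuis operators, \<open>\<beta> = 1 + M\<close> is a single unipotent Jordan block, so its commutant is
  the algebra of polynomials in \<open>M\<close>, and \<open>N = p + q M + r M\<^sup>2\<close> (\<open>commute_beta2_matrix\<close>).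
  Evaluating the Nijenhuis identity at the one pair \<open>(e\<^sub>2, e\<^sub>3)\<close> gives \<open>q\<^sup>2 = 0\<close>.  Conversely
  \<open>M\<^sup>2\<close> maps \<open>x\<close> to \<open>x\<^sub>3 e\<^sub>1\<close>, and every \<open>p + r M\<^sup>2\<close> satisfies the identity, as substituting the
  coordinates shows.
\<close>

section \<open>Twisting a Lie bracket by an endomorphism\<close>

text \<open>
  Since \<open>\<beta>\<close> preserves the Lie bracket \<open>b\<close>, the nested bracket \<open>[\<beta>\<^sup>2 x, [\<beta> y, z]]\<close> of the
  twist is \<open>b (\<beta>\<^sup>2 x) (b (\<beta>\<^sup>2 y) (\<beta>\<^sup>2 z))\<close>; the powers in the BiHom-Jacobi identity are those
  that turn it into the Jacobi identity of \<open>b\<close> at \<open>\<beta>\<^sup>2 x, \<beta>\<^sup>2 y, \<beta>\<^sup>2 z\<close>.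
\<close>

lemma bihom_lie_algebra_twist:
  fixes scl :: "complex \<Rightarrow> 'a::ab_group_add \<Rightarrow> 'a"
  assumes right: "\<And>x. Vector_Spaces.linear scl scl (\<lambda>y. b x y)"
    and left: "\<And>y. Vector_Spaces.linear scl scl (\<lambda>x. b x y)"
    and skew: "\<And>x y. b x y = - b y x"
    and jacobi: "\<And>x y z. b x (b y z) + b y (b z x) + b z (b x y) = 0"
    and lin: "Vector_Spaces.linear scl scl \<beta>"
    and hom: "\<And>x y. \<beta> (b x y) = b (\<beta> x) (\<beta> y)"
  shows "bihom_lie_algebra scl (\<lambda>x y. b x (\<beta> y)) id \<beta>"
proof -
  have vs: "vector_space scl"
    using lin by (simp add: Vector_Spaces.linear_def)
  have rt: "Vector_Spaces.linear scl scl (\<lambda>y. b x (\<beta> y))" for x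
    using Vector_Spaces.linear_compose[OF lin right] by (simp add: o_def)
  show ?thesis
    by (intro bihom_lie_algebra.intro bihom_lie_algebra_axioms.intro)
       (simp_all add: vs rt left lin vector_space.linear_id hom jacobi,
         metis skew)
qed

section \<open>The bracket as a twist\<close>

text \<open>
  The combination of the minors of \<open>(x, y)\<close> forced by \<open>bracket2 x y = untwisted2 x (beta2 y)\<close>;
  the associated brackets of basis vectors are \<open>{e\<^sub>1, e\<^sub>2} = 2 e\<^sub>1\<close>,
  \<open>{e\<^sub>1, e\<^sub>3} = - e\<^sub>1 + 2 e\<^sub>2\<close> and \<open>{e\<^sub>2, e\<^sub>3} = e\<^sub>1 + e\<^sub>2 + 2 e\<^sub>3\<close>.
\<close>

definition untwisted2 :: "complex^3 \<Rightarrow> complex^3 \<Rightarrow> complex^3" where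
  "untwisted2 x y =
    (let m12 = x $ 1 * y $ 2 - x $ 2 * y $ 1;
         m13 = x $ 1 * y $ 3 - x $ 3 * y $ 1;
         m23 = x $ 2 * y $ 3 - x $ 3 * y $ 2
     in vector [2 * m12 - m13 + m23, 2 * m13 + m23, 2 * m23])"

lemma untwisted2_nth:
  "untwisted2 x y $ 1 = 2 * (x $ 1 * y $ 2 - x $ 2 * y $ 1)
     - (x $ 1 * y $ 3 - x $ 3 * y $ 1) + (x $ 2 * y $ 3 - x $ 3 * y $ 2)"
  "untwisted2 x y $ 2 = 2 * (x $ 1 * y $ 3 - x $ 3 * y $ 1) + (x $ 2 * y $ 3 - x $ 3 * y $ 2)"
  "untwisted2 x y $ 3 = 2 * (x $ 2 * y $ 3 - x $ 3 * y $ 2)"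
  by (simp_all add: untwisted2_def Let_def)

lemma beta2_nth:
  "beta2 x $ 1 = x $ 1 + x $ 2"
  "beta2 x $ 2 = x $ 2 + x $ 3"
  "beta2 x $ 3 = x $ 3"
  by (simp_all add: beta2_def matrix_vector_mult_def sum_3)

lemma bracket2_eq_untwisted2: "bracket2 x y = untwisted2 x (beta2 y)"
  by (simp add: vec_eq_iff forall_3 untwisted2_nth beta2_nth bracket2_def bracket2_table_def
      sum_3 axis_def algebra_simps)

lemma bihom_lie_algebra_bracket2: "bihom_lie_algebra (*s) bracket2 alpha2 beta2"
proof -
  have "bihom_lie_algebra (*s) (\<lambda>x y. untwisted2 x (beta2 y)) id beta2"
  proof (rule bihom_lie_algebra_twist)
    show "Vector_Spaces.linear (*s) (*s) beta2"
      by (simp add: beta2_def matrix_vector_mul_linear_gen)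
  qed (unfold_locales,
       simp_all add: vec_eq_iff forall_3 untwisted2_nth beta2_nth algebra_simps)
  then show ?thesis
    by (simp add: bracket2_eq_untwisted2[abs_def] alpha2_def)
qed

section \<open>Nijenhuis operators\<close>

lemma linear_nth_3:
  fixes N :: "complex^3 \<Rightarrow> complex^3"
  assumes "Vector_Spaces.linear (*s) (*s) N"
  shows "N x $ i = matrix N $ i $ 1 * x $ 1 + matrix N $ i $ 2 * x $ 2 + matrix N $ i $ 3 * x $ 3"
  using arg_cong[OF matrix_works[OF assms, of x], of "\<lambda>v. v $ i"]
  by (simp add: matrix_vector_mult_def sum_3)

text \<open>
  The commutant of a Jordan block: the matrix is upper triangular and constant along diagonals.
  The conditions come from comparing \<open>N (\<beta> e\<^sub>j)\<close> with \<open>\<beta> (N e\<^sub>j)\<close>.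
\<close>

lemma commute_beta2_matrix:
  assumes lin: "Vector_Spaces.linear (*s) (*s) N" and comm: "N \<circ> beta2 = beta2 \<circ> N"
  obtains p q r where "matrix N = vector [vector [p, q, r], vector [0, p, q], vector [0, 0, p]]"
proof -
  let ?A = "matrix N"
  have eq: "N (beta2 (eb j)) $ i = beta2 (N (eb j)) $ i" for i j
    using comm by (simp add: fun_eq_iff)
  have "?A $ 2 $ 1 = 0" "?A $ 3 $ 1 = 0" "?A $ 3 $ 2 = 0"
       "?A $ 2 $ 2 = ?A $ 1 $ 1" "?A $ 3 $ 3 = ?A $ 1 $ 1" "?A $ 2 $ 3 = ?A $ 1 $ 2"
    using eq[of 1 1] eq[of 1 2] eq[of 2 1] eq[of 2 2] eq[of 3 1] eq[of 3 2]
    by (simp_all add: linear_nth_3[OF lin] beta2_nth axis_def)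
  then have "?A = vector [vector [?A $ 1 $ 1, ?A $ 1 $ 2, ?A $ 1 $ 3],
                          vector [0, ?A $ 1 $ 1, ?A $ 1 $ 2], vector [0, 0, ?A $ 1 $ 1]]"
    by (simp add: vec_eq_iff forall_3)
  then show thesis by (rule that)
qed

text \<open>
  At \<open>(e\<^sub>2, e\<^sub>3)\<close> the two sides of the Nijenhuis identity differ by \<open>2 q\<^sup>2 e\<^sub>1\<close>, where \<open>q\<close> is the
  superdiagonal entry of \<open>N\<close>.
\<close>

lemma nijenhuis_bracket2_matrix:
  assumes "nijenhuis_operator (*s) bracket2 alpha2 beta2 N"
  shows "\<exists>p r. matrix N = vector [vector [p, 0, r], vector [0, p, 0], vector [0, 0, p]]"
proof -
  have lin: "Vector_Spaces.linear (*s) (*s) N" and comm: "N \<circ> beta2 = beta2 \<circ> N"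
    and nij: "bracket2 (N x) (N y) = N (bracket2 (N x) y + bracket2 x (N y) - N (bracket2 x y))"
    for x y
    using assms by (simp_all add: nijenhuis_operator_def)
  obtain p q r where A: "matrix N = vector [vector [p, q, r], vector [0, p, q], vector [0, 0, p]]"
    using lin comm by (rule commute_beta2_matrix)
  have "q * q = 0"
    using arg_cong[OF nij[of "eb 2" "eb 3"], of "\<lambda>v. v $ 1"]
    by (simp add: bracket2_eq_untwisted2 untwisted2_nth beta2_nth linear_nth_3[OF lin] A axis_def
        algebra_simps)
  with A show ?thesis by auto
qed

lemma nijenhuis_bracket2I:
  assumes lin: "Vector_Spaces.linear (*s) (*s) N"
    and A: "matrix N = vector [vector [p, 0, r], vector [0, p, 0], vector [0, 0, p]]"
  shows "nijenhuis_operator (*s) bracket2 alpha2 beta2 N"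
  using lin
  by (simp add: nijenhuis_operator_def alpha2_def fun_eq_iff vec_eq_iff forall_3
      bracket2_eq_untwisted2 untwisted2_nth beta2_nth linear_nth_3[OF lin] A algebra_simps)

theorem theorem4p1:
  "bihom_lie_algebra (*s) bracket2 alpha2 beta2 \<and>
   {N. nijenhuis_operator (*s) bracket2 alpha2 beta2 N} =
   {N. Vector_Spaces.linear (*s) (*s) N \<and>
       (\<exists>r33 r13 :: complex.
          matrix N = vector [vector [r33, 0, r13],
                             vector [0, r33, 0],
                             vector [0, 0, r33]])}"
proof (intro conjI Collect_cong iffI)
  show "bihom_lie_algebra (*s) bracket2 alpha2 beta2"
    by (rule bihom_lie_algebra_bracket2)
next
  fix N :: "complex^3 \<Rightarrow> complex^3"
  assume "nijenhuis_operator (*s) bracket2 alpha2 beta2 N"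
  then show "Vector_Spaces.linear (*s) (*s) N"
    and "\<exists>r33 r13. matrix N = vector [vector [r33, 0, r13], vector [0, r33, 0], vector [0, 0, r33]]"
    by (simp add: nijenhuis_operator_def, rule nijenhuis_bracket2_matrix)
qed (blast intro: nijenhuis_bracket2I)

end
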